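(* Let $X$ be a real Hilbert space, $A$ and $B$ closed subsets of $X$, $\delta>0$ and $q>0$. Suppose that $$\max\Big\{\|b-a\|^{q-2}d\big(b-a,N^F_A(a)\big),\ \|b-a\|^{-1}d\big(a-b,N^F_B(b)\big)\Big\}\ge\delta$$ for all $a\in A$ and $b\in B$ such that $d(b,A)>d(A,B)$. Let $(x_n)$ be a sequence of alternating projections for $A$ and $B$ (with some initial point $x_0\in X$). (i) If either $d(A,B)>0$ or $q>1$, then there is an $n\in\mathbb{N}$ such that $\|x_n-x_{n-1}\|=d(A,B)$. (ii) If $d(A,B)=0$, then $\|x_n-x_{n-1}\|\to0$ as $n\to\infty$. Moreover, (a) if $q>1$, then there is an $n\in\mathbb{N}$ such that $x_n\in A\cap B$; (b) if $q=1$, then for all $n\ge1$, $$\|x_{2n}-x_{2n-1}\|\le(1-\delta^2)\|x_{2n-1}-x_{2n-2}\|;$$ if $\dim X<\infty$, then $A\cap B\ne\emptyset$, and the sequence $(x_n)$ converges to a point in $A\cap B$.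
   Context: $X$ is not assumed finite dimensional (unless stated) and is identified with its dual. $d(x,S)$ is the distance from a point to a set and $d(A,B):=\inf_{a\in A,\,b\in B}\|a-b\|$. For $\Omega\subset X$ and $\omega\in\Omega$, the Fréchet normal cone is $$N^F_\Omega(\omega):=\Big\{x^*\in X\ \Big|\ \limsup_{\Omega\ni x\to\omega}\frac{\langle x^*,x-\omega\rangle}{\|x-\omega\|}\le0\Big\}.$$ A sequence of alternating projections is a sequence $(x_n)$ satisfying, with some initial point $x_0\in X$, the conditions $x_{2n-1}\in P_B(x_{2n-2})$ and $x_{2n}\in P_A(x_{2n-1})$ for $n=1,2,\ldots$, where $P_\Omega(x):=\{\omega\in\Omega:\|x-\omega\|=d(x,\Omega)\}$. $\mathbb{N}=\{1,2,\ldots\}$.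
   Formalization: In (ii)(b) the inequality is claimed for all n≥2, but for n=1 only if x_0∈A and δ≤1; as stated it fails at n=1, e.g. A the x-axis, B the diagonal of the plane, x_0=(1,1), or A=X=ℝ, B={0}, δ=2, x_0=1. *)

theory Defs
  imports "HOL-Analysis.Analysis" "HOL-Library.Extended_Real"
begin

text \<open>The limit superior is taken in the extended reals over punctured neighbourhoods. At an isolated
  point of \<open>\<Omega>\<close> the filter is trivial and the limit superior is \<open>-\<infinity>\<close>, so the cone is the whole space.\<close>

definition frechet_normal_cone :: "'a::real_inner set \<Rightarrow> 'a \<Rightarrow> 'a set" where
  "frechet_normal_cone \<Omega> \<omega> =
     {v. Limsup (at \<omega> within \<Omega>) (\<lambda>x. ereal (inner v (x - \<omega>) / norm (x - \<omega>))) \<le> 0}"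

definition proj_set :: "'a::real_normed_vector set \<Rightarrow> 'a \<Rightarrow> 'a set" where
  "proj_set \<Omega> x = {\<omega> \<in> \<Omega>. norm (x - \<omega>) = infdist x \<Omega>}"

text \<open>The initial point \<open>x 0\<close> is arbitrary. The existence of such a sequence forces \<open>A\<close> and \<open>B\<close> to be
  nonempty, so the conventions of \<^const>\<open>infdist\<close> and \<^const>\<open>setdist\<close> for the empty set play no role.\<close>

definition alternating_projections ::
    "'a::real_normed_vector set \<Rightarrow> 'a set \<Rightarrow> (nat \<Rightarrow> 'a) \<Rightarrow> bool" where
  "alternating_projections A B x \<longleftrightarrow>
     (\<forall>n\<ge>1. x (2*n - 1) \<in> proj_set B (x (2*n - 2)) \<and> x (2*n) \<in> proj_set A (x (2*n - 1)))"

end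

theory Submission
  imports Defs
begin

text \<open>
  If \<open>b\<close> is a projection of \<open>a\<close> onto \<open>B\<close>, then \<open>a - b\<close> is normal to \<open>B\<close> at \<open>b\<close>, and \<open>u - b\<close> stays at angle
  less than \<open>arcsin \<delta>\<close> to this normal as long as \<open>\<parallel>u - a\<parallel> < \<delta> \<parallel>a - b\<parallel>\<close>. For such \<open>u \<in> A\<close> the hypothesis
  therefore bounds the distance of \<open>b - u\<close> to the normal cone of \<open>A\<close> from below, which says that
  \<open>u \<mapsto> \<parallel>u - b\<parallel>\<close> has slope at least \<open>\<delta> \<parallel>u - b\<parallel> powr (1 - q)\<close> on \<open>A\<close>. Descending at this rate over the
  radius \<open>\<delta> \<parallel>a - b\<parallel>\<close> shortens the next step by a factor \<open>1 - \<sigma>\<delta>\<close> (with \<open>\<sigma> = \<delta>\<close> for \<open>q = 1\<close>). If the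
  step lengths had a positive limit, \<open>\<sigma>\<close> could be chosen uniformly, a contradiction; so they reach
  \<open>d(A,B)\<close> or tend to \<open>0\<close>. For \<open>q > 1\<close>, the hypothesis at \<open>u = a\<close> excludes arbitrarily short steps
  before termination.
\<close>

section \<open>Frechet normal cones in inner product spaces\<close>

lemma norm_diff_sq:
  fixes x y :: "'a::real_inner"
  shows "(norm (x - y))\<^sup>2 = (norm x)\<^sup>2 - 2 * inner x y + (norm y)\<^sup>2"
  using dot_norm_neg[of x y] by argo

text \<open>The filter excludes \<open>w\<close>, so the denominator can be cleared. What remains is
  a real inequality, with no extended reals and no special case at isolated points.\<close>

lemma frechet_normal_cone_iff:
  "v \<in> frechet_normal_cone S w \<longleftrightarrow>
     (\<forall>e>0. eventually (\<lambda>x. inner v (x - w) \<le> e * norm (x - w)) (at w within S))"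
proof -
  have *: "inner v (x - w) / norm (x - w) \<le> e \<longleftrightarrow> inner v (x - w) \<le> e * norm (x - w)"
    if "x \<noteq> w" for x e using that by (simp add: field_simps)
  have ev: "eventually (\<lambda>x. x \<noteq> w) (at w within S)"
    by (simp add: eventually_at_filter)
  show ?thesis
  proof
    assume L: "v \<in> frechet_normal_cone S w"
    show "\<forall>e>0. eventually (\<lambda>x. inner v (x - w) \<le> e * norm (x - w)) (at w within S)"
    proof (intro allI impI)
      fix e :: real assume "e > 0"
      then have "eventually (\<lambda>x. ereal (inner v (x - w) / norm (x - w)) < ereal e) (at w within S)"
        using L[unfolded frechet_normal_cone_def mem_Collect_eq Limsup_le_iff, rule_format, of "ereal e"]
        by simp
      with ev show "eventually (\<lambda>x. inner v (x - w) \<le> e * norm (x - w)) (at w within S)"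
        by eventually_elim (use * in force)
    qed
  next
    assume R: "\<forall>e>0. eventually (\<lambda>x. inner v (x - w) \<le> e * norm (x - w)) (at w within S)"
    have le: "Limsup (at w within S) (\<lambda>x. ereal (inner v (x - w) / norm (x - w))) \<le> ereal e"
      if "e > 0" for e
    proof (rule Limsup_bounded)
      show "eventually (\<lambda>x. ereal (inner v (x - w) / norm (x - w)) \<le> ereal e) (at w within S)"
        using R[rule_format, OF that] ev by eventually_elim (use * in force)
    qed
    have "Limsup (at w within S) (\<lambda>x. ereal (inner v (x - w) / norm (x - w))) \<le> 0"
      using le by (intro ereal_le_epsilon2[of _ 0] allI impI) (simp only: add_0_left)
    then show "v \<in> frechet_normal_cone S w"
      by (simp add: frechet_normal_cone_def)
  qed
qed

lemma frechet_normal_cone_zero: "0 \<in> frechet_normal_cone S w"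
  by (simp add: frechet_normal_cone_iff)

lemma frechet_normal_cone_scale:
  assumes "v \<in> frechet_normal_cone S w" and "t > 0"
  shows "t *\<^sub>R v \<in> frechet_normal_cone S w"
  unfolding frechet_normal_cone_iff
proof (intro allI impI)
  fix e :: real assume "e > 0"
  then have "eventually (\<lambda>x. inner v (x - w) \<le> e / t * norm (x - w)) (at w within S)"
    using assms[unfolded frechet_normal_cone_iff] by (meson divide_pos_pos)
  then show "eventually (\<lambda>x. inner (t *\<^sub>R v) (x - w) \<le> e * norm (x - w)) (at w within S)"
    by eventually_elim (use assms(2) in \<open>simp add: field_simps\<close>)
qed

text \<open>Fermat's rule: near a minimiser over \<open>S\<close> the increments of \<open>h\<close>
  are nonnegative and agree with \<open>inner g\<close> to first order.\<close>

lemma frechet_normal_cone_local_min: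
  assumes d: "(h has_derivative (\<lambda>y. inner g y)) (at u)"
    and m: "eventually (\<lambda>v. h u \<le> h v) (at u within S)"
  shows "- g \<in> frechet_normal_cone S u"
  unfolding frechet_normal_cone_iff
proof (intro allI impI)
  fix e :: real assume "e > 0"
  then obtain d where "d > 0" and D: "\<And>y. norm (y - u) < d \<Longrightarrow>
      norm (h y - h u - inner g (y - u)) \<le> e * norm (y - u)"
    using d unfolding has_derivative_at_alt by blast
  have "eventually (\<lambda>y. norm (y - u) < d) (at u within S)"
    using \<open>d > 0\<close> by (auto simp: eventually_at dist_norm)
  with m show "eventually (\<lambda>x. inner (- g) (x - u) \<le> e * norm (x - u)) (at u within S)"
    by eventually_elim (use D in fastforce)
qed

text \<open>Fermat's rule for half the squared distance to \<open>a\<close>, whose gradient at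
  \<open>b\<close> is \<open>b - a\<close>.\<close>

lemma proximal_normal:
  assumes "b \<in> proj_set S a"
  shows "a - b \<in> frechet_normal_cone S b"
proof -
  have "((\<lambda>v. inner (v - a) (v - a) / 2) has_derivative (\<lambda>y. inner (b - a) y)) (at b)"
    by (auto intro!: derivative_eq_intros simp: inner_commute)
  moreover have "inner (b - a) (b - a) \<le> inner (v - a) (v - a)" if "v \<in> S" for v
  proof -
    have "norm (a - b) \<le> norm (a - v)"
      using assms infdist_le[OF that, of a] by (simp add: proj_set_def dist_norm)
    then have "(norm (b - a))\<^sup>2 \<le> (norm (v - a))\<^sup>2"
      by (simp add: norm_minus_commute)
    then show ?thesis by (simp only: power2_norm_eq_inner)
  qed
  then have "eventually (\<lambda>v. inner (b - a) (b - a) / 2 \<le> inner (v - a) (v - a) / 2) (at b within S)"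
    by (auto simp: eventually_at intro!: exI[of _ 1])
  ultimately have "- (b - a) \<in> frechet_normal_cone S b"
    by (rule frechet_normal_cone_local_min)
  then show ?thesis by simp
qed

lemma infdist_frechet_normal_cone_le: "infdist v (frechet_normal_cone S w) \<le> norm v"
  using infdist_le[OF frechet_normal_cone_zero, of v S w] by (simp add: dist_norm)

text \<open>The sine of an acute angle between \<open>p\<close> and \<open>p'\<close> is at most
  \<open>norm (p' - p) / norm p\<close>, and \<open>norm p'\<close> times this sine is the distance
  from \<open>p'\<close> to the ray through \<open>p\<close>, which lies in the cone.\<close>

lemma infdist_frechet_normal_cone_less:
  assumes p: "p \<in> frechet_normal_cone S w" and near: "norm (p' - p) < d * norm p" and "p' \<noteq> 0"
  shows "infdist p' (frechet_normal_cone S w) < d * norm p'"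
proof (cases "inner p p' > 0")
  case False
  \<comment> \<open>Without an acute angle, \<open>near\<close> forces \<open>d > 1\<close>, and the
    normal vector 0 is already close enough.\<close>
  have "(norm p)\<^sup>2 \<le> (norm (p' - p))\<^sup>2"
    using False norm_diff_sq[of p' p] zero_le_power2[of "norm p'"] inner_commute[of p p'] by linarith
  then have "norm p \<le> norm (p' - p)" by (simp add: power2_le_iff_abs_le)
  with near have "norm p < d * norm p" by linarith
  then have "d > 1" using mult_right_mono[of d 1 "norm p"] by fastforce
  then have "norm p' < d * norm p'" using \<open>p' \<noteq> 0\<close> by simp
  with infdist_frechet_normal_cone_le[of p' S w] show ?thesis by linarith
next
  case True
  then have p0: "p \<noteq> 0" by auto
  \<comment> \<open>\<open>t *\<^sub>R p\<close> is the orthogonal projection of \<open>p'\<close>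
    onto the line of \<open>p\<close>.\<close>
  define t where "t = inner p p' / (norm p)\<^sup>2"
  have "t > 0" using True p0 by (simp add: t_def)
  have d0: "d > 0" using near p0
    by (smt (verit) norm_ge_zero zero_less_norm_iff mult_nonpos_nonneg)
  have e1: "(norm p)\<^sup>2 * (norm (p' - t *\<^sub>R p))\<^sup>2 = (norm p)\<^sup>2 * (norm p')\<^sup>2 - (inner p p')\<^sup>2"
  proof -
    have "(norm (p' - t *\<^sub>R p))\<^sup>2 = (norm p')\<^sup>2 - 2 * t * inner p p' + t\<^sup>2 * (norm p)\<^sup>2"
      by (simp add: norm_diff_sq power_mult_distrib inner_commute)
    also have "\<dots> = (norm p')\<^sup>2 - (inner p p')\<^sup>2 / (norm p)\<^sup>2"
      using p0 by (simp add: t_def field_simps power2_eq_square)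
    finally show ?thesis using p0 by (simp add: field_simps)
  qed
  \<comment> \<open>The left side is the Gram determinant. By symmetry it also measures the distance
    from \<open>p\<close> to the line of \<open>p'\<close>; the gap is a perfect square.\<close>
  have e2: "(norm p)\<^sup>2 * (norm p')\<^sup>2 - (inner p p')\<^sup>2 \<le> (norm p')\<^sup>2 * (norm (p' - p))\<^sup>2"
  proof -
    have "(norm (p' - p))\<^sup>2 = (norm p')\<^sup>2 - 2 * inner p p' + (norm p)\<^sup>2"
      by (simp add: norm_diff_sq inner_commute)
    then have "(norm p')\<^sup>2 * (norm (p' - p))\<^sup>2 - ((norm p)\<^sup>2 * (norm p')\<^sup>2 - (inner p p')\<^sup>2)
       = ((norm p')\<^sup>2 - inner p p')\<^sup>2"
      by (simp only:) (simp add: power2_eq_square algebra_simps)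
    then show ?thesis by (smt (verit) zero_le_power2)
  qed
  have "(norm p * norm (p' - t *\<^sub>R p))\<^sup>2 \<le> (norm p' * norm (p' - p))\<^sup>2"
    using e1 e2 by (simp add: power_mult_distrib)
  then have "norm p * norm (p' - t *\<^sub>R p) \<le> norm p' * norm (p' - p)"
    by (rule power2_le_imp_le) simp
  also have "\<dots> < norm p' * (d * norm p)"
    using near \<open>p' \<noteq> 0\<close> by simp
  finally have "norm p * norm (p' - t *\<^sub>R p) < norm p * (d * norm p')" by (simp add: mult_ac)
  then have "norm (p' - t *\<^sub>R p) < d * norm p'" using p0 by (simp add: mult_less_cancel_left)
  then show ?thesis
    using infdist_le[OF frechet_normal_cone_scale[OF p \<open>t > 0\<close>], of p'] by (simp add: dist_norm)
qed

section \<open>Summable steps and the smooth variational principle\<close>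

lemma convergent_if_summable_steps:
  fixes u :: "nat \<Rightarrow> 'a::{real_normed_vector, complete_space}"
  assumes b: "summable b" and step: "\<And>n. norm (u (Suc n) - u n) \<le> b n"
  shows "convergent u"
proof -
  have bound: "norm (u (n + k) - u n) \<le> (\<Sum>i=n..<n+k. b i)" for n k
  proof (induction k)
    case (Suc k)
    have "norm (u (n + Suc k) - u n) \<le> norm (u (Suc (n + k)) - u (n + k)) + norm (u (n + k) - u n)"
      using norm_triangle_ineq[of "u (Suc (n + k)) - u (n + k)" "u (n + k) - u n"] by simp
    with Suc step[of "n + k"] show ?case by simp
  qed simp
  have "Cauchy u"
  proof (rule CauchyI)
    fix e :: real assume "e > 0"
    then obtain N where N: "\<And>m n. m \<ge> N \<Longrightarrow> norm (sum b {m..<n}) < e"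
      using b unfolding summable_Cauchy by blast
    have "norm (u n - u m) < e" if "m \<ge> N" "m \<le> n" for m n
      using bound[of m "n - m"] N[of m n] that by simp
    then show "\<exists>M. \<forall>m\<ge>M. \<forall>n\<ge>M. norm (u m - u n) < e"
      by (metis nat_le_linear norm_minus_commute)
  qed
  then show ?thesis by (rule Cauchy_convergent)
qed

text \<open>The Borwein--Preiss principle. The perturbation is quadratic, hence smooth, which avoids the fuzzy
  sum rule that Ekeland's principle would require. Completeness is used through Cauchy sequences
  because \<^class>\<open>banach\<close> is not inferred from \<^class>\<open>real_inner\<close> and \<^class>\<open>complete_space\<close>.\<close>

lemma smooth_variational_principle:
  fixes S :: "'a::{real_inner, complete_space} set" and g :: "'a \<Rightarrow> real"
  assumes S: "closed S" "S \<noteq> {}" "S \<subseteq> cball a R"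
    and g: "continuous_on S g" "\<And>v. v \<in> S \<Longrightarrow> m \<le> g v" and k: "k > 0"
  obtains u z where "u \<in> S" "z \<in> cball a R"
    "\<And>v. v \<in> S \<Longrightarrow> g u + k * (norm (u - z))\<^sup>2 \<le> g v + k * (norm (v - z))\<^sup>2"
proof -
  \<comment> \<open>The weights sum to \<open>k\<close>, so the full series of quadratics is one
    quadratic with leading coefficient \<open>k\<close>.\<close>
  define w :: "nat \<Rightarrow> real" where "w i = k * (1/2) ^ Suc i" for i
  have w0: "w i > 0" for i using k by (simp add: w_def)
  have wsum: "w sums k"
    using sums_mult[OF power_half_series, of k] by (simp add: w_def[abs_def])
  define G where "G u n v = g v + (\<Sum>i<n. w i * (norm (v - u i))\<^sup>2)" for u :: "nat \<Rightarrow> 'a" and n v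
  \<comment> \<open>This tolerance makes \<open>2 * \<eta> n / w n\<close> geometric; that quotient
    will bound the squared steps.\<close>
  define \<eta> where "\<eta> n = w n * (1/4) ^ n" for n
  have \<eta>0: "\<eta> n > 0" for n using w0 by (simp add: \<eta>_def)
  have G_lower: "m \<le> G u n v" if "v \<in> S" for u n v
    using g(2)[OF that] w0 unfolding G_def
    by (smt (verit) sum_nonneg mult_nonneg_nonneg zero_le_power2)
  have near: "\<exists>y\<in>S. \<forall>v\<in>S. G u n y \<le> G u n v + \<eta> n" for u n
  proof -
    have bdd: "bdd_below (G u n ` S)" using G_lower by (auto intro!: bdd_belowI2)
    have "Inf (G u n ` S) < Inf (G u n ` S) + \<eta> n" using \<eta>0 by simp
    then obtain y where "y \<in> S" "G u n y < Inf (G u n ` S) + \<eta> n"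
      using S(2) cInf_lessD[of "G u n ` S"] by blast
    moreover have "Inf (G u n ` S) \<le> G u n v" if "v \<in> S" for v
      using cINF_lower[OF bdd that] .
    ultimately show ?thesis by (intro bexI[of _ y] ballI) (meson add_right_mono less_le_trans less_imp_le)+
  qed
  \<comment> \<open>Each point is chosen in view of all earlier ones, so the choice is by
    well-founded recursion, which needs this locality.\<close>
  have G_cong: "G u n = G u' n" if "\<And>i. i < n \<Longrightarrow> u i = u' i" for u u' n
    using that by (auto simp: G_def fun_eq_iff)
  have "\<exists>f. \<forall>n. f n \<in> S \<and> (\<forall>v\<in>S. G f n (f n) \<le> G f n v + \<eta> n)"
  proof -
    have "\<exists>f. \<forall>n. (\<lambda>f n y. y \<in> S \<and> (\<forall>v\<in>S. G f n y \<le> G f n v + \<eta> n)) f n (f n)"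
    proof (rule dependent_wf_choice[OF wf_less_than])
      show "(y \<in> S \<and> (\<forall>v\<in>S. G f n y \<le> G f n v + \<eta> n)) =
            (y \<in> S \<and> (\<forall>v\<in>S. G f' n y \<le> G f' n v + \<eta> n))"
        if "\<And>i. (i, n) \<in> less_than \<Longrightarrow> f i = f' i" for f f' n y
        using G_cong[of n f f'] that by simp
      show "\<exists>y. y \<in> S \<and> (\<forall>v\<in>S. G f n y \<le> G f n v + \<eta> n)" for n f
        using near[of f n] by blast
    qed
    then show ?thesis by blast
  qed
  then obtain u where uS: "\<And>n. u n \<in> S"
    and umin: "\<And>n v. v \<in> S \<Longrightarrow> G u n (u n) \<le> G u n v + \<eta> n" by blast
  \<comment> \<open>Near-minimality is used at stages \<open>n\<close> and \<open>Suc n\<close>; the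
    newly added term vanishes at \<open>u n\<close>.\<close>
  have step: "norm (u (Suc n) - u n) \<le> 2 * (1/2) ^ n" for n
  proof -
    have "G u n (u n) \<le> G u n (u (Suc n)) + \<eta> n" using umin uS by blast
    moreover have "G u (Suc n) (u (Suc n)) = G u n (u (Suc n)) + w n * (norm (u (Suc n) - u n))\<^sup>2"
      by (simp add: G_def)
    moreover have "G u (Suc n) (u (Suc n)) \<le> G u (Suc n) (u n) + \<eta> (Suc n)" using umin uS by blast
    moreover have "G u (Suc n) (u n) = G u n (u n)" by (simp add: G_def)
    moreover have "\<eta> (Suc n) \<le> \<eta> n" using w0[of n] k by (simp add: \<eta>_def w_def)
    ultimately have "w n * (norm (u (Suc n) - u n))\<^sup>2 \<le> 2 * \<eta> n" by linarith
    also have "\<dots> \<le> w n * (2 * (1/2) ^ n)\<^sup>2"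
    proof -
      have "((1/2::real) ^ n)\<^sup>2 = (1/4) ^ n"
        by (simp add: power2_eq_square flip: power_mult_distrib)
      then have "(2 * (1/2::real) ^ n)\<^sup>2 = 4 * (1/4) ^ n" by (simp add: power_mult_distrib)
      then show ?thesis using w0[of n] by (simp add: \<eta>_def)
    qed
    finally have "(norm (u (Suc n) - u n))\<^sup>2 \<le> (2 * (1/2) ^ n)\<^sup>2" using w0[of n] by simp
    then show ?thesis by (rule power2_le_imp_le) simp
  qed
  have "summable (\<lambda>n. 2 * (1/2::real) ^ n)"
    by (intro summable_mult summable_geometric) simp
  then have "convergent u" using step by (rule convergent_if_summable_steps)
  then obtain y where y: "u \<longlonglongrightarrow> y" by (auto simp: convergent_def)
  have yS: "y \<in> S" using S(1) uS y by (rule closed_sequentially)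
  have uR: "norm (u n - a) \<le> R" for n
    using uS[of n] S(3) by (auto simp: dist_norm norm_minus_commute)
  have zterm: "norm ((1/2) ^ Suc i *\<^sub>R (u i - a)) \<le> R * (1/2) ^ Suc i" for i
    using mult_right_mono[OF uR[of i], of "(1/2) ^ Suc i"] by (simp add: mult.commute)
  \<comment> \<open>Partial sums for the barycentre \<open>z\<close> of the points
    \<open>u i\<close>, the centre of the limiting quadratic.\<close>
  define Z where "Z n = (\<Sum>i<n. (1/2) ^ Suc i *\<^sub>R (u i - a))" for n
  have hs: "(\<lambda>i. R * (1/2) ^ Suc i) sums R" using sums_mult[OF power_half_series, of R] by simp
  have "convergent Z"
    by (rule convergent_if_summable_steps[OF sums_summable[OF hs]])
       (use zterm in \<open>simp add: Z_def del: power_Suc\<close>)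
  then obtain z' where z': "Z \<longlonglongrightarrow> z'" by (auto simp: convergent_def)
  define z where "z = a + z'"
  have zs: "(\<lambda>i. (1/2) ^ Suc i *\<^sub>R (u i - a)) sums (z - a)"
    using z' by (simp add: sums_def z_def Z_def[abs_def])
  have "norm (Z n) \<le> (\<Sum>i<n. R * (1/2) ^ Suc i)" for n
    unfolding Z_def by (rule sum_norm_le) (rule zterm)
  then have "norm (z - a) \<le> R"
    using LIMSEQ_le[OF tendsto_norm[OF zs[unfolded sums_def]] hs[unfolded sums_def]]
    by (auto simp: Z_def)
  then have zR: "z \<in> cball a R" by (simp add: dist_norm norm_minus_commute)
  define c where "c = (\<Sum>i. w i * (norm (u i - a))\<^sup>2)"
  have csum: "(\<lambda>i. w i * (norm (u i - a))\<^sup>2) sums c"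
  proof -
    have "summable (\<lambda>i. w i * R\<^sup>2)" using wsum by (auto intro: summable_mult2 sums_summable)
    then have "summable (\<lambda>i. w i * (norm (u i - a))\<^sup>2)"
      by (rule summable_comparison_test'[where N=0])
         (simp add: uR w0 less_imp_le mult_left_mono power_mono)
    then show ?thesis unfolding c_def by (rule summable_sums)
  qed
  have ssum: "(\<lambda>i. w i *\<^sub>R (u i - a)) sums (k *\<^sub>R (z - a))"
    using sums_scaleR_right[OF zs, of k] by (simp add: w_def[abs_def])
  have expand: "w i * (norm (v - u i))\<^sup>2 =
      w i * (norm (v - a))\<^sup>2 - 2 * inner (v - a) (w i *\<^sub>R (u i - a)) + w i * (norm (u i - a))\<^sup>2" for v i
  proof -
    have "(norm (v - u i))\<^sup>2 = (norm (v - a))\<^sup>2 - 2 * inner (v - a) (u i - a) + (norm (u i - a))\<^sup>2"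
      using norm_diff_sq[of "v - a" "u i - a"] by simp
    then show ?thesis by (simp only: inner_scaleR_right) (simp only: ring_distribs ac_simps)
  qed
  \<comment> \<open>After expansion about \<open>a\<close>, the index enters only through three
    partial sums, so the limit can be taken along the moving argument \<open>u n\<close>
    too.\<close>
  define H where "H n v = g v + ((\<Sum>i<n. w i) * (norm (v - a))\<^sup>2
      - 2 * inner (v - a) (\<Sum>i<n. w i *\<^sub>R (u i - a)) + (\<Sum>i<n. w i * (norm (u i - a))\<^sup>2))" for n v
  have GH: "G u n v = H n v" for n v
    unfolding G_def H_def expand
    by (simp add: sum.distrib sum_subtractf sum_distrib_left sum_distrib_right inner_sum_right)
  define L where "L v = g v + (k * (norm (v - a))\<^sup>2 - 2 * inner (v - a) (k *\<^sub>R (z - a)) + c)" for v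
  have lim1: "(\<lambda>n. H n v) \<longlonglongrightarrow> L v" for v
    unfolding H_def L_def by (intro tendsto_intros wsum[unfolded sums_def] ssum[unfolded sums_def]
      csum[unfolded sums_def])
  have gy: "(\<lambda>n. g (u n)) \<longlonglongrightarrow> g y"
    using g(1) y yS uS unfolding continuous_on_sequentially by (auto simp: o_def)
  have lim2: "(\<lambda>n. H n (u n)) \<longlonglongrightarrow> L y"
    unfolding H_def L_def by (intro tendsto_intros gy y wsum[unfolded sums_def] ssum[unfolded sums_def]
      csum[unfolded sums_def])
  have "\<eta> \<longlonglongrightarrow> 0 * 0"
    unfolding \<eta>_def using sums_summable[OF wsum, THEN summable_LIMSEQ_zero]
    by (intro tendsto_mult LIMSEQ_power_zero) auto
  then have \<eta>lim: "\<eta> \<longlonglongrightarrow> 0" by simp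
  have min: "L y \<le> L v" if "v \<in> S" for v
  proof -
    have "(\<lambda>n. H n v + \<eta> n) \<longlonglongrightarrow> L v + 0" by (intro tendsto_add lim1 \<eta>lim)
    then show ?thesis using LIMSEQ_le[OF lim2, of _ "L v"] umin[OF that] GH by auto
  qed
  \<comment> \<open>Completing the square; the constant cancels when two values of \<open>L\<close>
    are compared.\<close>
  have Lz: "L v = g v + k * (norm (v - z))\<^sup>2 + (c - k * (norm (z - a))\<^sup>2)" for v
  proof -
    have "(norm (v - z))\<^sup>2 = (norm (v - a))\<^sup>2 - 2 * inner (v - a) (z - a) + (norm (z - a))\<^sup>2"
      using norm_diff_sq[of "v - a" "z - a"] by simp
    then show ?thesis unfolding L_def inner_scaleR_right by algebra
  qed
  show thesis
  proof (rule that[OF yS zR])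
    show "g y + k * (norm (y - z))\<^sup>2 \<le> g v + k * (norm (v - z))\<^sup>2" if "v \<in> S" for v
      using min[OF that] Lz[of y] Lz[of v] by linarith
  qed
qed

section \<open>Descent of the distance to a point along a set\<close>

text \<open>If the descent failed, a perturbation of \<open>norm (v - b) + c * norm (v - a)\<close>
  with \<open>c < \<sigma>\<close> would attain its minimum over \<open>A\<close> locally inside the
  ball. Fermat's rule would then give a normal vector too close to \<open>b - u\<close>.\<close>

lemma infdist_descent:
  fixes A :: "'a::{real_inner, complete_space} set"
  assumes A: "closed A" "a \<in> A" "b \<notin> A" and pos: "\<sigma> > 0" "\<rho> > 0"
    and slope: "\<And>u. u \<in> A \<Longrightarrow> norm (u - a) < \<rho> \<Longrightarrow>
      \<sigma> * norm (b - u) \<le> infdist (b - u) (frechet_normal_cone A u)"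
  shows "infdist b A \<le> norm (b - a) - \<sigma> * \<rho>"
proof (rule ccontr)
  define r where "r = norm (b - a)"
  assume "\<not> ?thesis"
  then have gap: "r - \<sigma> * \<rho> < infdist b A" by (simp add: r_def)
  \<comment> \<open>Slope and radius are shrunk slightly while the gap stays strict; this leaves
    room for smoothing and perturbation.\<close>
  have "((\<lambda>t. r - (\<sigma> * (1 - t)) * (\<rho> * (1 - t))) \<longlongrightarrow> r - (\<sigma> * (1 - 0)) * (\<rho> * (1 - 0))) (at_right 0)"
    by (intro tendsto_intros)
  then have "eventually (\<lambda>t. r - (\<sigma> * (1 - t)) * (\<rho> * (1 - t)) < infdist b A) (at_right 0)"
    using gap by (intro order_tendstoD(2)) auto
  moreover have "eventually (\<lambda>t. t \<in> {0<..<1}) (at_right (0::real))"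
    by (rule eventually_at_right_real) simp
  ultimately obtain t :: real where t: "0 < t" "t < 1"
    "r - (\<sigma> * (1 - t)) * (\<rho> * (1 - t)) < infdist b A"
    using eventually_happens'[OF _ eventually_conj] by (metis (no_types, lifting) trivial_limit_at_right_real greaterThanLessThan_iff)
  define c R where "c = \<sigma> * (1 - t)" and "R = \<rho> * (1 - t)"
  have c: "0 < c" "c < \<sigma>" and R: "0 < R" "R < \<rho>" using pos t by (auto simp: c_def R_def)
  define e where "e = infdist b A - (r - c * R)"
  have e: "e > 0" using t by (simp add: e_def c_def R_def)
  \<comment> \<open>At \<open>a\<close>, smoothing costs \<open>e / 4\<close> and the perturbation
    at most \<open>e / 4\<close>, together less than the gap \<open>e\<close>. The second bound on
    \<open>k\<close> keeps the perturbation's gradient below \<open>\<sigma> - c\<close>.\<close>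
  define s where "s = e / (4 * c)"
  define k where "k = min (e / (4 * R\<^sup>2)) ((\<sigma> - c) / (8 * R))"
  have s: "s > 0" "c * s = e / 4" using e c by (auto simp: s_def)
  have k0: "k > 0" using e c R by (simp add: k_def)
  have k1: "k * R\<^sup>2 \<le> e / 4" 
  proof -
    have "k * R\<^sup>2 \<le> e / (4 * R\<^sup>2) * R\<^sup>2" by (intro mult_right_mono) (auto simp: k_def)
    then show ?thesis using R by simp
  qed
  have k2: "4 * k * R < \<sigma> - c"
  proof -
    have "k * (4 * R) \<le> (\<sigma> - c) / (8 * R) * (4 * R)" using R by (intro mult_right_mono) (auto simp: k_def)
    also have "\<dots> < \<sigma> - c" using R c by (simp add: field_simps)
    finally show ?thesis by (simp add: mult_ac)
  qed
  \<comment> \<open>A smooth surrogate of \<open>c * norm (v - a)\<close>, which keeps the minimiser in the open ball of radius \<open>R\<close>.\<close>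
  define \<phi> where "\<phi> v = sqrt ((norm (v - a))\<^sup>2 + s\<^sup>2)" for v
  define g where "g v = norm (v - b) + c * \<phi> v" for v
  define S where "S = A \<inter> cball a R"
  have aS: "a \<in> S" using A R by (simp add: S_def)
  have "continuous_on S g"
    unfolding g_def \<phi>_def by (intro continuous_intros)
  moreover have "0 \<le> g v" for v using c by (simp add: g_def \<phi>_def)
  moreover have "closed S" "S \<subseteq> cball a R" using A by (auto simp: S_def)
  ultimately obtain u z where uS: "u \<in> S" and z: "z \<in> cball a R"
    and min: "\<And>v. v \<in> S \<Longrightarrow> g u + k * (norm (u - z))\<^sup>2 \<le> g v + k * (norm (v - z))\<^sup>2"
    using smooth_variational_principle[of S a R g 0 k] aS k0 by blast
  have uA: "u \<in> A" using uS by (simp add: S_def)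
  have ub: "norm (u - b) > 0" using uA A(3) by auto
  have \<phi>_pos: "\<phi> v > 0" and \<phi>_ge: "norm (v - a) \<le> \<phi> v" for v
    using s by (auto simp: \<phi>_def add_nonneg_pos intro!: real_le_rsqrt)
  \<comment> \<open>Comparison of the minimiser \<open>u\<close> with the competitor
    \<open>a\<close>.\<close>
  have "norm (u - a) < R"
  proof -
    have "infdist b A \<le> norm (u - b)"
      using infdist_le[OF uA, of b] by (simp add: dist_norm norm_minus_commute)
    moreover have "norm (u - b) + c * norm (u - a) \<le> g u"
      using \<phi>_ge[of u] c by (simp add: g_def)
    moreover have "g u \<le> g u + k * (norm (u - z))\<^sup>2" using k0 by simp
    moreover have "g a = r + c * s"
      using s by (simp add: g_def \<phi>_def r_def norm_minus_commute)
    moreover have "k * (norm (a - z))\<^sup>2 \<le> k * R\<^sup>2"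
      using z k0 by (intro mult_left_mono power_mono) (auto simp: dist_norm)
    ultimately have "c * norm (u - a) < c * R"
      using min[OF aS] k1 s(2) e e_def by argo
    then show ?thesis using c by simp
  qed
  \<comment> \<open>The gradient at \<open>u\<close> of everything except
    \<open>norm (v - b)\<close>.\<close>
  define w where "w = (c / \<phi> u) *\<^sub>R (u - a) + (2 * k) *\<^sub>R (u - z)"
  have "norm w \<le> c + 2 * k * (2 * R)"
  proof -
    have "norm (u - z) \<le> norm (u - a) + norm (a - z)"
      using norm_triangle_ineq[of "u - a" "a - z"] by simp
    then have "norm (u - z) \<le> 2 * R"
      using \<open>norm (u - a) < R\<close> z by (simp add: dist_norm)
    then have "norm ((2 * k) *\<^sub>R (u - z)) \<le> 2 * k * (2 * R)" using k0 by simp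
    moreover have "c * norm (u - a) / \<phi> u \<le> c"
      using \<phi>_pos[of u] \<phi>_ge[of u] c by (simp add: field_simps)
    then have "norm ((c / \<phi> u) *\<^sub>R (u - a)) \<le> c"
      using \<phi>_pos[of u] c by simp
    ultimately show ?thesis unfolding w_def by (rule norm_triangle_le[OF add_mono, rotated])
  qed
  then have w: "norm w < \<sigma>" using k2 by linarith
  let ?h = "\<lambda>v. g v + k * (norm (v - z))\<^sup>2"
  have "(?h has_derivative (\<lambda>y. inner (sgn (u - b) + w) y)) (at u)"
  proof -
    have 1: "((\<lambda>v. norm (v - b)) has_derivative (\<lambda>y. inner (sgn (u - b)) y)) (at u)"
    proof -
      have "((\<lambda>v. v - b) has_derivative (\<lambda>y. y)) (at u)"
        by (auto intro!: derivative_eq_intros)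
      moreover have "(norm has_derivative (\<lambda>y. inner (sgn (u - b)) y)) (at (u - b))"
        using ub GDERIV_norm[of "u - b"] by (simp add: gderiv_def inner_commute)
      ultimately show ?thesis by (rule has_derivative_compose)
    qed
    have sq: "((\<lambda>v. (norm (v - y))\<^sup>2) has_derivative (\<lambda>x. 2 * inner (u - y) x)) (at u)" for y
      unfolding power2_norm_eq_inner by (auto intro!: derivative_eq_intros simp: inner_commute)
    have "((\<lambda>v. (norm (v - a))\<^sup>2 + s\<^sup>2) has_derivative (\<lambda>x. 2 * inner (u - a) x + 0)) (at u)"
      by (intro has_derivative_add sq has_derivative_const)
    moreover have "(norm (u - a))\<^sup>2 + s\<^sup>2 > 0" using s by (simp add: add_nonneg_pos)
    ultimately have der: "((\<lambda>v. sqrt ((norm (v - a))\<^sup>2 + s\<^sup>2)) has_derivative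
        (\<lambda>x. (2 * inner (u - a) x + 0) * (inverse (sqrt ((norm (u - a))\<^sup>2 + s\<^sup>2)) / 2))) (at u)"
      by (intro has_derivative_real_sqrt)
    have 2: "(\<phi> has_derivative (\<lambda>x. inner (u - a) x / \<phi> u)) (at u)"
    proof -
      have "(\<lambda>x. (2 * inner (u - a) x + 0) * (inverse (sqrt ((norm (u - a))\<^sup>2 + s\<^sup>2)) / 2))
          = (\<lambda>x. inner (u - a) x / \<phi> u)"
        by (rule ext) (simp only: \<phi>_def divide_inverse, simp)
      moreover have "(\<lambda>v. sqrt ((norm (v - a))\<^sup>2 + s\<^sup>2)) = \<phi>"
        by (rule ext) (simp only: \<phi>_def)
      ultimately show ?thesis using der by simp
    qed
    show ?thesis unfolding g_def
      by (rule has_derivative_eq_rhs, rule has_derivative_add[OF has_derivative_add[OF 1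
        has_derivative_mult_right[OF 2]] has_derivative_mult_right[OF sq]])
        (simp add: w_def fun_eq_iff inner_add_left)
  qed
  moreover have "eventually (\<lambda>v. ?h u \<le> ?h v) (at u within A)"
  proof -
    have "?h u \<le> ?h v" if "v \<in> A" "dist v u < R - norm (u - a)" for v
    proof (rule min)
      have "norm (v - a) \<le> norm (v - u) + norm (u - a)"
        using norm_triangle_ineq[of "v - u" "u - a"] by simp
      then show "v \<in> S" using that by (simp add: S_def dist_norm norm_minus_commute)
    qed
    then show ?thesis using \<open>norm (u - a) < R\<close>
      by (auto simp: eventually_at intro!: exI[of _ "R - norm (u - a)"])
  qed
  ultimately have "- (sgn (u - b) + w) \<in> frechet_normal_cone A u"
    by (rule frechet_normal_cone_local_min)
  \<comment> \<open>Scaling by \<open>norm (u - b)\<close> turns the unit vector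
    \<open>- sgn (u - b)\<close> into \<open>b - u\<close>.\<close>
  from frechet_normal_cone_scale[OF this ub]
  have "norm (u - b) *\<^sub>R (- (sgn (u - b) + w)) \<in> frechet_normal_cone A u" .
  also have "norm (u - b) *\<^sub>R (- (sgn (u - b) + w)) = (b - u) - norm (u - b) *\<^sub>R w"
    using ub by (simp add: sgn_div_norm algebra_simps)
  finally have "(b - u) - norm (u - b) *\<^sub>R w \<in> frechet_normal_cone A u" .
  from infdist_le[OF this, of "b - u"]
  have "infdist (b - u) (frechet_normal_cone A u) \<le> norm (b - u) * norm w"
    by (simp add: dist_norm norm_minus_commute[of u b])
  also have "\<dots> < \<sigma> * norm (b - u)"
    using w ub by (simp add: norm_minus_commute mult.commute)
  also have "\<dots> \<le> infdist (b - u) (frechet_normal_cone A u)"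
    using slope[OF uA] \<open>norm (u - a) < R\<close> R by simp
  finally show False by simp
qed

text \<open>Here \<open>t\<close> stands for the distance from \<open>b\<close> to a point of
  \<open>A\<close> in the ball of radius \<open>\<delta> * norm (b - a)\<close> about
  \<open>a\<close>. A lower bound \<open>\<sigma>\<close> uniform in \<open>t\<close> is the slope
  fed into \<open>infdist_descent\<close>.\<close>

lemma infdist_alternation_step:
  fixes A B :: "'a::{real_inner, complete_space} set"
  assumes "closed A" and pos: "\<delta> > 0" "\<sigma> > 0"
    and cond: "\<And>a b. a \<in> A \<Longrightarrow> b \<in> B \<Longrightarrow> infdist b A > setdist A B \<Longrightarrow>
           max (norm (b - a) powr (q - 2) * infdist (b - a) (frechet_normal_cone A a))
               (inverse (norm (b - a)) * infdist (a - b) (frechet_normal_cone B b)) \<ge> \<delta>"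
    and a: "a \<in> A" and b: "b \<in> proj_set B a" and far: "infdist b A > setdist A B"
    and \<sigma>: "\<And>t. infdist b A \<le> t \<Longrightarrow> t \<le> (1 + \<delta>) * norm (b - a) \<Longrightarrow> \<sigma> \<le> \<delta> * t powr (1 - q)"
  shows "infdist b A \<le> (1 - \<sigma> * \<delta>) * norm (b - a)"
proof -
  have "b \<in> B" using b by (simp add: proj_set_def)
  have d0: "infdist b A > 0" using far setdist_pos_le[of A B] by linarith
  then have "b \<notin> A" by auto
  then have ba: "norm (b - a) > 0" using a by auto
  have "infdist b A \<le> norm (b - a) - \<sigma> * (\<delta> * norm (b - a))"
  proof (rule infdist_descent)
    show "closed A" "a \<in> A" "b \<notin> A" "\<sigma> > 0" by fact+
    show "\<delta> * norm (b - a) > 0" using ba pos by simp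
    fix u assume u: "u \<in> A" and near: "norm (u - a) < \<delta> * norm (b - a)"
    define t where "t = norm (b - u)"
    have dt: "infdist b A \<le> t" using infdist_le[OF u, of b] by (simp add: dist_norm t_def)
    then have t0: "t > 0" using d0 by linarith
    have "t \<le> norm (b - a) + norm (u - a)"
      using norm_triangle_ineq4[of "b - a" "u - a"] by (simp add: t_def)
    then have "t \<le> (1 + \<delta>) * norm (b - a)" using near by (simp add: distrib_right)
    with dt have \<sigma>t: "\<sigma> \<le> \<delta> * t powr (1 - q)" by (rule \<sigma>)
    \<comment> \<open>The second entry of the maximum is below \<open>\<delta>\<close>, so the first
      must reach it.\<close>
    have "infdist (u - b) (frechet_normal_cone B b) < \<delta> * norm (u - b)"
      using near t0
      by (intro infdist_frechet_normal_cone_less[OF proximal_normal[OF b]])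
        (auto simp: t_def norm_minus_commute)
    then have "inverse (norm (b - u)) * infdist (u - b) (frechet_normal_cone B b) < \<delta>"
      using t0 by (simp add: t_def norm_minus_commute field_simps)
    then have "\<delta> \<le> t powr (q - 2) * infdist (b - u) (frechet_normal_cone A u)"
      using cond[OF u \<open>b \<in> B\<close> far] by (simp add: t_def)
    then have le: "\<delta> * t powr (2 - q) \<le> infdist (b - u) (frechet_normal_cone A u)"
      using t0 by (simp add: powr_diff field_simps)
    have eq: "t powr (2 - q) = t powr (1 - q) * t"
      using t0 powr_add[of t "1 - q" 1] by simp
    have "\<sigma> * t \<le> \<delta> * t powr (1 - q) * t" using \<sigma>t t0 by (intro mult_right_mono) auto
    also have "\<dots> \<le> infdist (b - u) (frechet_normal_cone A u)" using le by (simp add: eq)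
    finally show "\<sigma> * norm (b - u) \<le> infdist (b - u) (frechet_normal_cone A u)"
      by (simp add: t_def)
  qed
  then show ?thesis by (simp add: algebra_simps)
qed

section \<open>Step lengths of alternating projections\<close>

locale transversal_alternation =
  fixes A B :: "'a::{real_inner, complete_space} set" and \<delta> q :: real and x :: "nat \<Rightarrow> 'a"
  assumes closed_A: "closed A" and closed_B: "closed B" and \<delta>_pos: "\<delta> > 0"
    and transversal: "\<And>a b. a \<in> A \<Longrightarrow> b \<in> B \<Longrightarrow> infdist b A > setdist A B \<Longrightarrow>
           max (norm (b - a) powr (q - 2) * infdist (b - a) (frechet_normal_cone A a))
               (inverse (norm (b - a)) * infdist (a - b) (frechet_normal_cone B b)) \<ge> \<delta>"
    and alternating: "alternating_projections A B x"
begin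

text \<open>Even indices give the steps onto \<open>B\<close>, odd indices the steps onto
  \<open>A\<close>.\<close>

definition step_length :: "nat \<Rightarrow> real" where
  "step_length n = norm (x (Suc n) - x n)"

lemma proj_B: "x (2 * n + 1) \<in> proj_set B (x (2 * n))"
  using alternating[unfolded alternating_projections_def, rule_format, of "Suc n"] by simp

lemma proj_A: "x (2 * n + 2) \<in> proj_set A (x (2 * n + 1))"
  using alternating[unfolded alternating_projections_def, rule_format, of "Suc n"] by simp

lemma in_B: "x (2 * n + 1) \<in> B"
  using proj_B by (simp add: proj_set_def)

lemma in_A: "n \<ge> 1 \<Longrightarrow> x (2 * n) \<in> A"
  using proj_A[of "n - 1"] by (cases n) (auto simp: proj_set_def)

lemma step_length_even: "step_length (2 * n) = infdist (x (2 * n)) B"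
  using proj_B[of n] by (simp add: proj_set_def step_length_def norm_minus_commute)

lemma step_length_odd: "step_length (2 * n + 1) = infdist (x (2 * n + 1)) A"
  using proj_A[of n] by (simp add: proj_set_def step_length_def norm_minus_commute)

lemma step_length_nonneg: "step_length n \<ge> 0"
  by (simp add: step_length_def)

text \<open>The point \<open>x n\<close> lies in the set onto which \<open>x (Suc n)\<close> is
  projected. At \<open>n = 0\<close> this can fail, since \<open>x 0\<close> may lie outside
  \<open>A\<close>.\<close>

lemma step_length_Suc_le:
  assumes "n \<ge> 1" shows "step_length (Suc n) \<le> step_length n"
proof (cases "even n")
  case True
  then obtain k where k: "n = 2 * k" by auto
  with assms show ?thesis
    using infdist_le[OF in_A[of k], of "x (2 * k + 1)"] step_length_odd[of k]
    by (simp add: step_length_def dist_norm)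
next
  case False
  then obtain k where k: "n = 2 * k + 1" by (auto elim: oddE)
  then show ?thesis
    using infdist_le[OF in_B[of k], of "x (2 * (k + 1))"] step_length_even[of "k + 1"]
    by (simp add: step_length_def dist_norm)
qed

lemma step_length_antimono:
  assumes "1 \<le> m" "m \<le> n" shows "step_length n \<le> step_length m"
  using assms(2)
proof (induction n rule: dec_induct)
  case (step n)
  with assms(1) step_length_Suc_le[of n] show ?case by simp
qed simp

lemma setdist_le_step_length:
  assumes "n \<ge> 1" shows "setdist A B \<le> step_length n"
proof (cases "even n")
  case True
  then obtain k where k: "n = 2 * k" by auto
  with assms show ?thesis
    using setdist_le_dist[OF in_A[of k] in_B[of k]]
    by (simp add: step_length_def dist_norm norm_minus_commute)
next
  case False
  then obtain k where k: "n = 2 * k + 1" by (auto elim: oddE)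
  then show ?thesis
    using setdist_le_dist[OF in_A[of "k + 1"] in_B[of k]]
    by (simp add: step_length_def dist_norm)
qed

text \<open>Assuming \<open>x (2 * n) \<in> A\<close> instead of \<open>n \<ge> 1\<close> admits the
  first step when the sequence starts in \<open>A\<close>.\<close>

lemma step_length_contracts:
  assumes n: "x (2 * n) \<in> A" and far: "step_length (2 * n + 1) > setdist A B" and "\<sigma> > 0"
    and \<sigma>: "\<And>t. step_length (2 * n + 1) \<le> t \<Longrightarrow> t \<le> (1 + \<delta>) * step_length (2 * n) \<Longrightarrow>
        \<sigma> \<le> \<delta> * t powr (1 - q)"
  shows "step_length (2 * n + 1) \<le> (1 - \<sigma> * \<delta>) * step_length (2 * n)"
proof -
  have e: "norm (x (2 * n + 1) - x (2 * n)) = step_length (2 * n)"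
    by (simp add: step_length_def)
  show ?thesis
    using infdist_alternation_step[OF closed_A \<delta>_pos \<open>\<sigma> > 0\<close> transversal n proj_B] far \<sigma>
    unfolding e step_length_odd by blast
qed

section \<open>Limit of the step lengths and finite termination\<close>

text \<open>The step lengths decrease to some \<open>l\<close>. If \<open>l > 0\<close> and
  \<open>setdist A B\<close> is never reached, one contraction factor below 1 serves all steps, and
  it survives in the limit.\<close>

lemma terminates_or_vanishes:
  "(\<exists>n\<ge>1. step_length n = setdist A B) \<or> step_length \<longlonglongrightarrow> 0"
proof (rule disjCI)
  assume not0: "\<not> step_length \<longlonglongrightarrow> 0"
  have dec: "decseq (\<lambda>n. step_length (n + 1))"
    using step_length_Suc_le by (intro decseq_SucI) simp
  obtain l where l': "(\<lambda>n. step_length (n + 1)) \<longlonglongrightarrow> l"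
    and l_bound: "\<forall>n. l \<le> step_length (n + 1)"
    by (rule decseq_convergent[OF dec, of 0]) (auto simp: step_length_nonneg)
  from l' have l: "step_length \<longlonglongrightarrow> l" by (rule LIMSEQ_offset)
  have l_le: "l \<le> step_length n" if "n \<ge> 1" for n
    using l_bound[rule_format, of "n - 1"] that by simp
  have "l \<ge> 0" using l step_length_nonneg by (intro LIMSEQ_le_const) auto
  with l not0 have l0: "l > 0" by (cases "l = 0") auto
  show "\<exists>n\<ge>1. step_length n = setdist A B"
  proof (rule ccontr)
    assume "\<not> ?thesis"
    then have far: "step_length n > setdist A B" if "n \<ge> 1" for n
      using setdist_le_step_length[OF that] that by force
    define h where "h = (1 + \<delta>) * step_length 1"
    \<comment> \<open>All relevant \<open>t\<close> lie between \<open>l\<close> and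
      \<open>h\<close>; a power is monotone there, so it is smallest at an endpoint, whichever the
      sign of \<open>1 - q\<close>.\<close>
    define \<sigma> where "\<sigma> = \<delta> * min (l powr (1 - q)) (h powr (1 - q))"
    have h0: "h > 0" using l0 l_le[of 1] \<delta>_pos by (simp add: h_def)
    then have \<sigma>0: "\<sigma> > 0" using l0 \<delta>_pos by (simp add: \<sigma>_def)
    have "step_length (2 * n + 1) \<le> (1 - \<sigma> * \<delta>) * step_length (2 * n)" if "n \<ge> 1" for n
    proof (rule step_length_contracts)
      show "x (2 * n) \<in> A" "\<sigma> > 0" "step_length (2 * n + 1) > setdist A B"
        using in_A far \<sigma>0 that by auto
      fix t assume "step_length (2 * n + 1) \<le> t" and t: "t \<le> (1 + \<delta>) * step_length (2 * n)"
      then have lt: "l \<le> t" using l_le[of "2 * n + 1"] by simp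
      have "step_length (2 * n) \<le> step_length 1"
        using that by (intro step_length_antimono) auto
      then have "(1 + \<delta>) * step_length (2 * n) \<le> h"
        unfolding h_def using \<delta>_pos by (intro mult_left_mono) auto
      with t have "t \<le> h" by simp
      then have "min (l powr (1 - q)) (h powr (1 - q)) \<le> t powr (1 - q)"
        using lt l0 powr_mono2[of "1 - q" l t] powr_mono2'[of "1 - q" t h]
        by (cases "1 - q \<ge> 0") (simp_all add: min_le_iff_disj)
      then show "\<sigma> \<le> \<delta> * t powr (1 - q)"
        using \<delta>_pos unfolding \<sigma>_def by (intro mult_left_mono) auto
    qed
    moreover have "(\<lambda>n. step_length (2 * n + 1)) \<longlonglongrightarrow> l"
      using LIMSEQ_subseq_LIMSEQ[OF l, of "\<lambda>n. 2 * n + 1"] by (simp add: strict_mono_def o_def)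
    moreover have "(\<lambda>n. (1 - \<sigma> * \<delta>) * step_length (2 * n)) \<longlonglongrightarrow> (1 - \<sigma> * \<delta>) * l"
      using LIMSEQ_subseq_LIMSEQ[OF l, of "\<lambda>n. 2 * n"]
      by (intro tendsto_intros) (simp add: strict_mono_def o_def)
    ultimately have "l \<le> (1 - \<sigma> * \<delta>) * l"
      by (intro LIMSEQ_le) auto
    then show False using l0 \<sigma>0 \<delta>_pos by (simp add: algebra_simps mult_le_0_iff)
  qed
qed

text \<open>A positive \<open>setdist A B\<close> rules out vanishing steps. For
  \<open>q > 1\<close>, the \<open>B\<close> term is zero at a projection, so the \<open>A\<close>
  term is at least \<open>\<delta>\<close>; but it is at most the step length to the power
  \<open>q - 1\<close>.\<close>

lemma finite_termination:
  assumes "setdist A B > 0 \<or> q > 1"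
  shows "\<exists>n\<ge>1. step_length n = setdist A B"
proof (rule ccontr)
  assume no: "\<not> ?thesis"
  then have lim: "step_length \<longlonglongrightarrow> 0" using terminates_or_vanishes by blast
  have far: "step_length n > setdist A B" if "n \<ge> 1" for n
    using setdist_le_step_length[OF that] that no by force
  have "setdist A B \<le> 0"
    using lim setdist_le_step_length by (intro LIMSEQ_le_const) auto
  with assms have q: "q > 1" by auto
  have "eventually (\<lambda>n. step_length n < \<delta> powr (1 / (q - 1))) sequentially"
    using lim \<delta>_pos by (intro order_tendstoD(2)) auto
  then obtain N where N: "\<And>n. n \<ge> N \<Longrightarrow> step_length n < \<delta> powr (1 / (q - 1))"
    by (auto simp: eventually_sequentially)
  \<comment> \<open>The shift ensures \<open>n \<ge> 1\<close>, hence
    \<open>x (2 * n) \<in> A\<close>.\<close>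
  define n where "n = N + 1"
  let ?a = "x (2 * n)" and ?b = "x (2 * n + 1)"
  have s: "norm (?b - ?a) = step_length (2 * n)" by (simp add: step_length_def)
  have s0: "step_length (2 * n) > 0"
    by (rule order.strict_trans1[OF setdist_pos_le far]) (simp add: n_def)
  have "?a - ?b \<in> frechet_normal_cone B ?b" by (rule proximal_normal[OF proj_B])
  then have "infdist (?a - ?b) (frechet_normal_cone B ?b) = 0" by simp
  moreover have "infdist ?b A > setdist A B"
    using far[of "2 * n + 1"] unfolding step_length_odd by simp
  ultimately have "\<delta> \<le> step_length (2 * n) powr (q - 2) * infdist (?b - ?a) (frechet_normal_cone A ?a)"
    using transversal[OF in_A[of n] in_B[of n]] \<delta>_pos unfolding s by (simp add: n_def)
  also have "\<dots> \<le> step_length (2 * n) powr (q - 2) * step_length (2 * n)"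
    using infdist_frechet_normal_cone_le[of "?b - ?a" A ?a] unfolding s by (intro mult_left_mono) auto
  also have "\<dots> = step_length (2 * n) powr (q - 1)"
    using s0 powr_add[of "step_length (2 * n)" "q - 2" 1] by simp
  also have "\<dots> < (\<delta> powr (1 / (q - 1))) powr (q - 1)"
    using q s0 N[of "2 * n"] by (intro powr_less_mono2) (auto simp: n_def)
  also have "\<dots> = \<delta>" using q \<delta>_pos by (simp add: powr_powr)
  finally show False by simp
qed

lemma step_length_tendsto_0:
  assumes "setdist A B = 0"
  shows "step_length \<longlonglongrightarrow> 0"
  using terminates_or_vanishes
proof
  assume "\<exists>n\<ge>1. step_length n = setdist A B"
  then obtain n where n: "n \<ge> 1" "step_length n = 0" using assms by auto
  have "step_length k = 0" if "k \<ge> n" for k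
    using step_length_antimono[OF n(1) that] n(2) step_length_nonneg[of k] by simp
  then show ?thesis
    by (intro tendsto_eventually) (auto simp: eventually_sequentially)
qed

lemma in_Int_if_step_length_0:
  assumes "n \<ge> 1" "step_length n = 0"
  shows "x n \<in> A \<inter> B"
proof -
  have eq: "x (Suc n) = x n" using assms(2) by (simp add: step_length_def)
  show ?thesis
  proof (cases "even n")
    case True
    then obtain k where "n = 2 * k" by auto
    then show ?thesis using in_A[of k] in_B[of k] eq assms(1) by simp
  next
    case False
    then obtain k where "n = 2 * k + 1" by (auto elim: oddE)
    then show ?thesis using in_A[of "k + 1"] in_B[of k] eq by simp
  qed
qed

section \<open>The linear case \<open>q = 1\<close>\<close>

text \<open>For \<open>q = 1\<close> the power is constantly 1 and
  \<open>\<sigma> = \<delta>\<close> is admissible. If the next step is zero, the claim amounts to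
  \<open>\<delta> \<le> 1\<close> unless the current step is zero too.\<close>

lemma linear_contraction:
  assumes m: "setdist A B = 0" and q: "q = 1" and a: "x (2 * n) \<in> A"
    and \<delta>1: "\<delta> \<le> 1 \<or> n \<ge> 1"
  shows "step_length (2 * n + 1) \<le> (1 - \<delta>\<^sup>2) * step_length (2 * n)"
proof (cases "step_length (2 * n + 1) > 0")
  case True
  have "step_length (2 * n + 1) \<le> (1 - \<delta> * \<delta>) * step_length (2 * n)"
    using True a m q \<delta>_pos by (intro step_length_contracts) auto
  then show ?thesis by (simp add: power2_eq_square)
next
  case False
  then have z: "step_length (2 * n + 1) = 0" using step_length_nonneg[of "2 * n + 1"] by simp
  show ?thesis
  proof (cases "step_length (2 * n) = 0")
    case False
    then have s: "step_length (2 * n) > 0" using step_length_nonneg[of "2 * n"] by simp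
    \<comment> \<open>The preceding step starts at a point of \<open>B\<close> outside
      \<open>A\<close>, so the hypothesis applies to its endpoints; both entries of the maximum are
      at most 1 because 0 is a normal vector.\<close>
    have "\<delta> \<le> 1"
    proof (rule ccontr)
      assume "\<not> \<delta> \<le> 1"
      with \<delta>1 obtain k where k: "n = k + 1" by (metis Suc_eq_plus1 Suc_pred' less_eq_Suc_le One_nat_def)
      let ?a = "x (2 * n)" and ?b = "x (2 * k + 1)"
      have "step_length (2 * k + 1) > 0"
        using s step_length_antimono[of "2 * k + 1" "2 * n"] k by simp
      then have "infdist ?b A > setdist A B" and ab: "norm (?b - ?a) > 0"
        unfolding step_length_odd m using step_length_odd[of k]
        by (auto simp: step_length_def k)
      then have "\<delta> \<le> max (norm (?b - ?a) powr (q - 2) * infdist (?b - ?a) (frechet_normal_cone A ?a))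
               (inverse (norm (?b - ?a)) * infdist (?a - ?b) (frechet_normal_cone B ?b))"
        using transversal[OF a in_B[of k]] by blast
      moreover have "norm (?b - ?a) powr (q - 2) = inverse (norm (?b - ?a))"
        using ab q by (simp add: powr_minus)
      moreover have "inverse (norm (?b - ?a)) * infdist (?b - ?a) (frechet_normal_cone A ?a) \<le> 1"
        using mult_left_mono[OF infdist_frechet_normal_cone_le[of "?b - ?a" A ?a],
          of "inverse (norm (?b - ?a))"] ab by simp
      moreover have "inverse (norm (?b - ?a)) * infdist (?a - ?b) (frechet_normal_cone B ?b) \<le> 1"
        using mult_left_mono[OF infdist_frechet_normal_cone_le[of "?a - ?b" B ?b],
          of "inverse (norm (?b - ?a))"] ab unfolding norm_minus_commute[of ?a ?b] by simp
      ultimately have "\<delta> \<le> 1" by (simp only: max.bounded_iff)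
      with \<open>\<not> \<delta> \<le> 1\<close> show False by simp
    qed
    then have "\<delta>\<^sup>2 \<le> 1" using \<delta>_pos by (simp add: power_le_one)
    then show ?thesis using s z by simp
  qed (use z in simp)
qed

text \<open>Contraction at every second step makes the lengths geometrically summable; closedness
  places the limit in both sets.\<close>

lemma converges_to_Int:
  assumes m: "setdist A B = 0" and q: "q = 1"
  shows "\<exists>l\<in>A \<inter> B. x \<longlonglongrightarrow> l"
proof -
  \<comment> \<open>The \<open>1/4\<close> keeps \<open>c\<close> positive when
    \<open>\<delta> \<ge> 1\<close>; the rate per single step is then its square root
    \<open>d\<close>.\<close>
  define c where "c = max (1/4) (1 - \<delta>\<^sup>2)"
  define d where "d = sqrt c"
  have c: "0 < c" "c < 1" using \<delta>_pos by (auto simp: c_def)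
  then have d: "0 < d" "d < 1" "d * d = c" by (auto simp: d_def real_sqrt_lt_1_iff)
  have cd: "c \<le> d" using d mult_left_mono[of d 1 d] by simp
  have even: "step_length (2 * n + 1) \<le> c * step_length (2 * n)" if "n \<ge> 1" for n
  proof -
    have "step_length (2 * n + 1) \<le> (1 - \<delta>\<^sup>2) * step_length (2 * n)"
      using that by (intro linear_contraction m q in_A) auto
    also have "\<dots> \<le> c * step_length (2 * n)"
      using step_length_nonneg by (intro mult_right_mono) (auto simp: c_def)
    finally show ?thesis .
  qed
  have two: "step_length (n + 2) \<le> c * step_length n" if "n \<ge> 2" for n
  proof (cases "even n")
    case True
    then obtain k where "n = 2 * k" by auto
    then show ?thesis using even[of k] step_length_Suc_le[of "n + 1"] that by simp
  next
    case False
    then obtain k where k: "n = 2 * k + 1" by (auto elim: oddE)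
    have "step_length (n + 2) \<le> c * step_length (n + 1)" using even[of "k + 1"] k by simp
    also have "\<dots> \<le> c * step_length n"
      using step_length_Suc_le[of n] that c by (intro mult_left_mono) auto
    finally show ?thesis .
  qed
  \<comment> \<open>The induction advances by two, so the second base case rests on
    \<open>c \<le> d\<close>.\<close>
  have geom: "step_length (n + 2) \<le> step_length 2 * d ^ n" for n
  proof (induction n rule: induct_nat_012)
    case 0
    show ?case by (simp add: numeral_2_eq_2)
  next
    case 1
    have "step_length 3 \<le> c * step_length 2" using even[of 1] by simp
    also have "\<dots> \<le> d * step_length 2" using cd step_length_nonneg by (intro mult_right_mono)
    finally show ?case by (simp add: mult.commute numeral_3_eq_3)
  next
    case (ge2 n)
    have "step_length (Suc (Suc n) + 2) \<le> c * step_length (n + 2)" using two[of "n + 2"] by simp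
    also have "\<dots> \<le> c * (step_length 2 * d ^ n)" using ge2(1) c by (intro mult_left_mono) auto
    also have "\<dots> = step_length 2 * d ^ Suc (Suc n)" by (simp flip: d(3))
    finally show ?case .
  qed
  have "summable (\<lambda>n. step_length 2 * d ^ n)"
    using d by (intro summable_mult summable_geometric) simp
  then have "convergent (\<lambda>n. x (n + 2))"
    by (rule convergent_if_summable_steps) (use geom in \<open>simp add: step_length_def\<close>)
  then obtain l where "(\<lambda>n. x (n + 2)) \<longlonglongrightarrow> l" by (auto simp: convergent_def)
  then have l: "x \<longlonglongrightarrow> l" by (rule LIMSEQ_offset)
  have "(\<lambda>n. x (2 * n + 1)) \<longlonglongrightarrow> l"
    using LIMSEQ_subseq_LIMSEQ[OF l, of "\<lambda>n. 2 * n + 1"] by (simp add: strict_mono_def o_def)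
  then have "l \<in> B"
    by (rule closed_sequentially[OF closed_B, rotated]) (rule in_B)
  moreover have "(\<lambda>n. x (2 * (n + 1))) \<longlonglongrightarrow> l"
    using LIMSEQ_subseq_LIMSEQ[OF l, of "\<lambda>n. 2 * (n + 1)"] by (simp add: strict_mono_def o_def)
  then have "l \<in> A"
    by (rule closed_sequentially[OF closed_A, rotated]) (rule in_A, simp)
  ultimately show ?thesis using l by blast
qed

end

text \<open>The premise for \<open>n = 1\<close> excludes real failures. If \<open>x 0\<close> lies
  in \<open>B\<close> but not in \<open>A\<close>, the first step is zero and the second is
  positive. If \<open>B\<close> is contained in \<open>A\<close>, the transversality condition is
  vacuous, so \<open>\<delta>\<close> may exceed 1 and the right side may be negative.\<close>

theorem corollary5p6:
  fixes A B :: "'a::{real_inner, complete_space} set"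
    and \<delta> q :: real
    and x :: "nat \<Rightarrow> 'a"
  assumes "closed A" and "closed B"
    and "\<delta> > 0" and "q > 0"
    and "\<And>a b. a \<in> A \<Longrightarrow> b \<in> B \<Longrightarrow> infdist b A > setdist A B \<Longrightarrow>
           max (norm (b - a) powr (q - 2) * infdist (b - a) (frechet_normal_cone A a))
               (inverse (norm (b - a)) * infdist (a - b) (frechet_normal_cone B b)) \<ge> \<delta>"
    and "alternating_projections A B x"
  shows "(setdist A B > 0 \<or> q > 1 \<longrightarrow> (\<exists>n\<ge>1. norm (x n - x (n - 1)) = setdist A B)) \<and>
         (setdist A B = 0 \<longrightarrow>
            (\<lambda>n. norm (x (Suc n) - x n)) \<longlonglongrightarrow> 0 \<and>
            (q > 1 \<longrightarrow> (\<exists>n\<ge>1. x n \<in> A \<inter> B)) \<and>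
            (q = 1 \<longrightarrow>
               (\<forall>n\<ge>1. (n = 1 \<longrightarrow> x 0 \<in> A \<and> \<delta> \<le> 1) \<longrightarrow>
                  norm (x (2*n) - x (2*n - 1)) \<le> (1 - \<delta>\<^sup>2) * norm (x (2*n - 1) - x (2*n - 2))) \<and>
               ((\<exists>S::'a set. finite S \<and> span S = UNIV) \<longrightarrow>
                  A \<inter> B \<noteq> {} \<and> (\<exists>l\<in>A \<inter> B. x \<longlonglongrightarrow> l))))"
proof -
  interpret transversal_alternation A B \<delta> q x
    by (unfold_locales) (fact assms)+
  have i: "\<exists>n\<ge>1. norm (x n - x (n - 1)) = setdist A B" if "setdist A B > 0 \<or> q > 1"
    \<comment> \<open>\<open>step_length n\<close> ends at \<open>x (Suc n)\<close>, so the witness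
      shifts by one.\<close>
    using finite_termination[OF that] unfolding step_length_def
    by (metis diff_Suc_1 le_SucI)
  have a: "\<exists>n\<ge>1. x n \<in> A \<inter> B" if "setdist A B = 0" "q > 1"
    using finite_termination in_Int_if_step_length_0 that by metis
  have b: "norm (x (2*n) - x (2*n - 1)) \<le> (1 - \<delta>\<^sup>2) * norm (x (2*n - 1) - x (2*n - 2))"
    if "setdist A B = 0" "q = 1" "n \<ge> 1" "n = 1 \<longrightarrow> x 0 \<in> A \<and> \<delta> \<le> 1" for n
  proof -
    \<comment> \<open>For \<open>k = 0\<close> the extra premise supplies the membership and the
      bound on \<open>\<delta>\<close>; for larger \<open>k\<close> they come from
      \<open>in_A\<close> and \<open>k \<ge> 1\<close>.\<close>
    obtain k where k: "n = Suc k" using \<open>n \<ge> 1\<close> by (cases n) auto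
    have "step_length (2 * k + 1) \<le> (1 - \<delta>\<^sup>2) * step_length (2 * k)"
      using that in_A[of k] k by (intro linear_contraction) (cases k; auto)+
    then show ?thesis by (simp add: step_length_def k)
  qed
  show ?thesis
    using i a b step_length_tendsto_0 converges_to_Int
    unfolding step_length_def[abs_def] by blast
qed

end
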